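(* Let $T$ be a tree with $n$ vertices, where $m=n/4\in\mathbb{N}$. If $T$ is spanned by $m$ vertex disjoint copies of $K_{1,3}\equiv S(1,1,1)$, then the graph Laplacian $L(T)$ has an eigenvalue exactly equal to $4$.
   Context: The graph Laplacian of a finite simple unweighted undirected graph $G$ with vertices $v_1,\dots,v_n$ is $L(G)=D(G)-A(G)$, where $D(G)$ is the diagonal matrix of vertex degrees and $A(G)$ is the adjacency matrix. $K_{1,3}$ is the star with one central vertex and three leaves. A tree $T=T(V,E)$ is said to be spanned by $\ell$ vertex disjoint copies of a graph $K$ if $T$ contains subgraphs $K_i(V_i,E_i)$, $i=1,\dots,\ell$, each isomorphic to $K$, such that $V=\bigcup_{i=1}^{\ell}V_i$ and $V_i\cap V_j=\emptyset$ for all $i\ne j$. *)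

theory Defs
  imports
    "Graph_Theory.Graph_Theory"
    "Jordan_Normal_Form.Char_Poly"
begin

text \<open>
  A finite simple undirected graph is a \<open>pair_graph\<close>: a finite set of vertices with a finite,
  irreflexive, symmetric set of arcs, where the edge \<open>{u, v}\<close> is the pair of
  opposite arcs \<open>(u, v)\<close> and \<open>(v, u)\<close>.

  The predicate \<open>tree\<close> of Graph_Theory is unusable for this encoding: it forbids all
  directed cycles, and the two arcs of a single edge already form one. The cycles of an
  undirected simple graph are those of length at least 3. Connectedness includes
  having at least one vertex.
\<close>

definition undirected_tree :: "'v pair_pre_digraph \<Rightarrow> bool" where
  "undirected_tree T \<longleftrightarrow>
     pair_graph T \<and> Digraph_Component.connected (with_proj T) \<and>
     \<not> (\<exists>p. pre_digraph.cycle (with_proj T) p \<and> 3 \<le> length p)"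

definition star13 :: "nat pair_pre_digraph" where
  "star13 = \<lparr> pverts = {0, 1, 2, 3}, parcs = {0} \<times> {1, 2, 3} \<union> {1, 2, 3} \<times> {0} \<rparr>"

lemma complete_bipartite_star13: "K\<^bsub>1,3\<^esub> (with_proj star13)"
proof -
  have "pverts star13 = {0} \<union> {1, 2, 3}" "{0} \<inter> {1, 2, 3::nat} = {}"
    "card {0::nat} = 1" "card {1, 2, 3::nat} = 3"
    "parcs star13 = {0} \<times> {1, 2, 3} \<union> {1, 2, 3} \<times> {0}"
    by (simp_all add: star13_def insert_commute)
  moreover have "finite (pverts star13)"
    by (simp add: star13_def)
  ultimately show ?thesis
    unfolding complete_bipartite_digraph_pair_def by blast
qed

lemma pair_graph_star13: "pair_graph star13"
  by (rule pair_graphI_complete_bipartite[OF complete_bipartite_star13])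

definition spanned_by_disjoint_copies ::
  "'w pair_pre_digraph \<Rightarrow> nat \<Rightarrow> 'v pair_pre_digraph \<Rightarrow> bool" where
  "spanned_by_disjoint_copies K l T \<longleftrightarrow>
     (\<exists>H :: nat \<Rightarrow> 'v pair_pre_digraph.
        (\<forall>i\<in>{1..l}. subgraph (with_proj (H i)) (with_proj T) \<and>
                     digraph_iso (with_proj K) (with_proj (H i))) \<and>
        pverts T = (\<Union>i\<in>{1..l}. pverts (H i)) \<and>
        (\<forall>i\<in>{1..l}. \<forall>j\<in>{1..l}. i \<noteq> j \<longrightarrow> pverts (H i) \<inter> pverts (H j) = {}))"

text \<open>
  The list \<open>vs\<close> is the enumeration of the vertices that indexes the rows and columns.
  In a symmetric digraph the out-degree of a vertex is its number of incident edges.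
\<close>

definition adjacency_matrix :: "'v list \<Rightarrow> 'v pair_pre_digraph \<Rightarrow> real mat" where
  "adjacency_matrix vs G =
     mat (length vs) (length vs) (\<lambda>(i, j). if (vs ! i, vs ! j) \<in> parcs G then 1 else 0)"

definition degree_matrix :: "'v list \<Rightarrow> 'v pair_pre_digraph \<Rightarrow> real mat" where
  "degree_matrix vs G =
     mat (length vs) (length vs)
       (\<lambda>(i, j). if i = j then real (out_degree (with_proj G) (vs ! i)) else 0)"

definition laplacian :: "'v list \<Rightarrow> 'v pair_pre_digraph \<Rightarrow> real mat" where
  "laplacian vs G = degree_matrix vs G - adjacency_matrix vs G"

end

theory Submission
  imports Defs
begin

text \<open>
  The Laplacian sends a function \<open>x\<close> on the vertices to \<open>v \<mapsto> (\<Sum>w. x v - x w)\<close>, the sum ranging over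
  the neighbours \<open>w\<close> of \<open>v\<close>. On a single star with \<open>k\<close> leaves, the function with value \<open>k\<close> at the
  centre and \<open>-1\<close> at each leaf is therefore an eigenfunction for \<open>k + 1\<close>. A tree partitioned into
  such stars has an eigenfunction that is a nonzero multiple of this one on each star, with
  the multiples chosen such that the two ends of every other edge have equal values: those edges
  contribute nothing to the sums, and what is left is the Laplacian of the separate stars.

  The multiples can be chosen because a tree has no cycles. Both requirements prescribe, for each
  edge, a nonzero ratio of the values at its ends: \<open>k : -1\<close> from centre to leaf on a star edge,
  and \<open>1 : 1\<close> on any other edge. On a graph with cycles the product of the ratios around a cycle
  would have to be \<open>1\<close>; on a tree every choice of ratios is realised by a nowhere vanishing function
  (\<open>undirected_tree_gain_potential\<close>), which is found by adding the vertices one at a time,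
  each joined by a single edge to those already reached (\<open>undirected_tree_grow_induct\<close>).
  For \<open>k = 3\<close> the eigenvalue is \<open>4\<close>.
\<close>

section \<open>Growing a tree vertex by vertex\<close>

text \<open>
  Connectedness of the subgraph induced by \<open>S\<close>, expressed by simple paths of \<open>G\<close> itself, so that
  closing such a path through a vertex outside \<open>S\<close> gives a cycle of \<open>G\<close> directly.
\<close>

definition inner_connected :: "'v pair_pre_digraph \<Rightarrow> 'v set \<Rightarrow> bool" where
  "inner_connected G S \<longleftrightarrow>
     (\<forall>u\<in>S. \<forall>v\<in>S. \<exists>p. pre_digraph.apath (with_proj G) u p v \<and> set (pawalk_verts u p) \<subseteq> S)"

lemma (in pair_graph) inner_connected_insert:
  assumes "inner_connected G S" and "u \<in> S" and "v \<notin> S" and uv: "(u, v) \<in> parcs G"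
  shows "inner_connected G (insert v S)"
proof -
  have vu: "(v, u) \<in> parcs G"
    using uv by (rule arcs_symmetric)
  have V: "u \<in> pverts G" "v \<in> pverts G"
    using uv by (auto dest: in_arcsD1 in_arcsD2)
  have path: "\<exists>p. apath a p b \<and> set (pawalk_verts a p) \<subseteq> S" if "a \<in> S" "b \<in> S" for a b
    using assms(1) that unfolding inner_connected_def by blast
  have "\<exists>p. apath a p b \<and> set (pawalk_verts a p) \<subseteq> insert v S"
    if ab: "a \<in> insert v S" "b \<in> insert v S" for a b
  proof -
    consider "a \<in> S" "b \<in> S" | "a = v" "b = v" | "a = v" "b \<in> S" | "a \<in> S" "b = v"
      using ab by auto
    then show ?thesis
    proof cases
      case 1
      then show ?thesis using path by blast
    next
      case 2
      then have "apath a [] b" using V by (simp add: apath_Nil_iff)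
      then show ?thesis using 2 by (intro exI[of _ "[]"]) auto
    next
      case 3
      obtain p where p: "apath u p b" "set (pawalk_verts u p) \<subseteq> S"
        using path[OF \<open>u \<in> S\<close> \<open>b \<in> S\<close>] by blast
      have "apath v ((v, u) # p) b"
        using p vu \<open>v \<notin> S\<close> by (auto simp: apath_Cons_iff)
      then show ?thesis using 3 p by (intro exI[of _ "(v, u) # p"]) auto
    next
      case 4
      obtain p where p: "apath a p u" "set (pawalk_verts a p) \<subseteq> S"
        using path[OF \<open>a \<in> S\<close> \<open>u \<in> S\<close>] by blast
      have aw: "awalk a p u" using p by (simp add: apath_def)
      have aw': "awalk a (p @ [(u, v)]) v"
        by (rule awalk_appendI[OF aw]) (use uv V in \<open>simp add: awalk_Cons_iff awalk_Nil_iff\<close>)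
      have vs: "pawalk_verts a (p @ [(u, v)]) = pawalk_verts a p @ [v]"
        using awalk_verts_append[OF aw'] aw by auto
      have "apath a (p @ [(u, v)]) v"
        using p aw' \<open>v \<notin> S\<close> unfolding apath_def vs by auto
      then show ?thesis using 4 p vs by (intro exI[of _ "p @ [(u, v)]"]) auto
    qed
  qed
  then show ?thesis unfolding inner_connected_def by blast
qed

text \<open>
  Two edges from \<open>v\<close> into a connected set close a cycle through \<open>v\<close>. It has length at least 3 since
  the path between their distinct ends inside the set is nonempty.
\<close>

lemma (in pair_graph) inner_connected_attach_unique:
  assumes acyc: "\<not> (\<exists>p. cycle p \<and> 3 \<le> length p)"
    and "inner_connected G S" and "u \<in> S" and "v \<notin> S"
    and uv: "(u, v) \<in> parcs G" and "u' \<in> S" and u'v: "(u', v) \<in> parcs G"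
  shows "u' = u"
proof (rule ccontr)
  assume "u' \<noteq> u"
  obtain p where p: "apath u p u'" "set (pawalk_verts u p) \<subseteq> S"
    using assms unfolding inner_connected_def by blast
  have vu: "(v, u) \<in> parcs G"
    using uv by (rule arcs_symmetric)
  have V: "u' \<in> pverts G" "v \<in> pverts G"
    using u'v by (auto dest: in_arcsD1 in_arcsD2)
  have aw: "awalk u p u'" using p by (simp add: apath_def)
  have "p \<noteq> []"
    using p \<open>u' \<noteq> u\<close> by (auto simp: apath_Nil_iff)
  have aw1: "awalk u (p @ [(u', v)]) v"
    by (rule awalk_appendI[OF aw]) (use u'v V in \<open>simp add: awalk_Cons_iff awalk_Nil_iff\<close>)
  then have aw2: "awalk v ((v, u) # p @ [(u', v)]) v"
    using vu V by (simp add: awalk_Cons_iff del: awalk_append_iff)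
  have vs: "pawalk_verts u (p @ [(u', v)]) = pawalk_verts u p @ [v]"
    using awalk_verts_append[OF aw1] aw by auto
  have "distinct (pawalk_verts u p @ [v])"
    using p \<open>v \<notin> S\<close> by (auto simp: apath_def)
  then have "cycle ((v, u) # p @ [(u', v)])"
    unfolding cycle_def using aw2 vs by (intro exI[of _ v]) simp
  moreover have "3 \<le> length ((v, u) # p @ [(u', v)])"
    using \<open>p \<noteq> []\<close> by (cases p) auto
  ultimately show False using acyc by blast
qed

lemma (in pair_graph) connected_leaving_arc:
  assumes "Digraph_Component.connected (with_proj G)"
    and "r \<in> S" and "S \<subset> pverts G"
  obtains u v where "u \<in> S" "v \<in> pverts G - S" "(u, v) \<in> parcs G"
proof -
  obtain z where z: "z \<in> pverts G" "z \<notin> S" using assms by blast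
  have "strongly_connected (with_proj G)"
    using symmetric_connected_imp_strongly_connected[OF pair_sym_arcs assms(1)] .
  then have rz: "r \<rightarrow>\<^sup>*\<^bsub>with_proj G\<^esub> z"
    using assms(2,3) z by (auto simp: strongly_connected_def)
  have "z \<in> S" if none: "\<forall>u v. u \<in> S \<longrightarrow> (u, v) \<in> parcs G \<longrightarrow> v \<in> S"
    using rz
  proof (induct rule: reachable_induct)
    case base
    then show ?case using \<open>r \<in> S\<close> by simp
  next
    case (step x y)
    then show ?case using none by auto
  qed
  then obtain u v where "u \<in> S" "(u, v) \<in> parcs G" "v \<notin> S" using z by blast
  then show thesis using that by (auto dest: in_arcsD2)
qed

text \<open>
  An induction along an exhaustion of the tree by connected vertex sets. Connectedness of the tree
  supplies an edge leaving the current set, and acyclicity makes it the only edge between the new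
  vertex and that set, so that a construction on the set extends without any compatibility
  condition.
\<close>

lemma undirected_tree_grow_induct [consumes 2, case_names root attach]:
  assumes T: "undirected_tree T" and r: "r \<in> pverts T"
    and base: "P {r}"
    and step: "\<And>S u v. \<lbrakk>S \<subseteq> pverts T; P S; u \<in> S; v \<in> pverts T - S; (u, v) \<in> parcs T;
                 \<And>u'. \<lbrakk>u' \<in> S; (u', v) \<in> parcs T\<rbrakk> \<Longrightarrow> u' = u\<rbrakk> \<Longrightarrow> P (insert v S)"
  shows "P (pverts T)"
proof -
  interpret pair_graph T using T by (simp add: undirected_tree_def)
  have con: "Digraph_Component.connected (with_proj T)"
    and acyc: "\<not> (\<exists>p. cycle p \<and> 3 \<le> length p)"
    using T by (auto simp: undirected_tree_def)
  have grown: "\<exists>S. S \<subseteq> pverts T \<and> r \<in> S \<and> card S = Suc k \<and> inner_connected T S \<and> P S"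
    if "k < card (pverts T)" for k
    using that
  proof (induct k)
    case 0
    have "apath r [] r" using r by (simp add: apath_Nil_iff)
    then have "inner_connected T {r}"
      unfolding inner_connected_def by (auto intro!: exI[of _ "[]"])
    then show ?case using r base by (intro exI[of _ "{r}"]) auto
  next
    case (Suc k)
    then obtain S where S: "S \<subseteq> pverts T" "r \<in> S" "card S = Suc k" "inner_connected T S" "P S"
      by auto
    then have "S \<subset> pverts T" using Suc.prems by auto
    then obtain u v where uv: "u \<in> S" "v \<in> pverts T - S" "(u, v) \<in> parcs T"
      using connected_leaving_arc[OF con \<open>r \<in> S\<close>] by blast
    have "P (insert v S)"
      using S uv inner_connected_attach_unique[OF acyc \<open>inner_connected T S\<close>]
      by (intro step[of S u v]) auto
    moreover have "inner_connected T (insert v S)"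
      using inner_connected_insert S uv by blast
    moreover have "card (insert v S) = Suc (Suc k)"
      using S uv finite_subset[OF S(1) pair_finite_verts] by simp
    ultimately show ?case using S uv by (intro exI[of _ "insert v S"]) auto
  qed
  have "card (pverts T) > 0"
    using r pair_finite_verts by (auto simp: card_gt_0_iff)
  then obtain S where S: "S \<subseteq> pverts T" "card S = card (pverts T)" "P S"
    using grown[of "card (pverts T) - 1"] by auto
  then have "S = pverts T"
    by (intro card_subset_eq[OF pair_finite_verts])
  then show ?thesis
    using \<open>P S\<close> by blast
qed

text \<open>
  Every gain function on a tree is balanced. In each step of the growth the value at the new vertex
  is dictated by the one edge that joins it to the vertices already treated.
\<close>

lemma undirected_tree_gain_potential:
  fixes g :: "'v \<Rightarrow> 'v \<Rightarrow> 'a::field"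
  assumes T: "undirected_tree T"
    and g: "\<And>u v. (u, v) \<in> parcs T \<Longrightarrow> g u v * g v u = 1"
  obtains x where "\<And>v. v \<in> pverts T \<Longrightarrow> x v \<noteq> 0"
    and "\<And>u v. (u, v) \<in> parcs T \<Longrightarrow> x u = g u v * x v"
proof -
  interpret pair_graph T using T by (simp add: undirected_tree_def)
  obtain r where r: "r \<in> pverts T"
    using T unfolding undirected_tree_def connected_def strongly_connected_def
    by auto
  define P where "P S \<longleftrightarrow> (\<exists>x. (\<forall>v\<in>S. x v \<noteq> 0) \<and>
      (\<forall>u\<in>S. \<forall>v\<in>S. (u, v) \<in> parcs T \<longrightarrow> x u = g u v * x v))" for S
  have sym: "(b, a) \<in> parcs T" if "(a, b) \<in> parcs T" for a b
    using that by (rule arcs_symmetric)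
  have "P (pverts T)"
    using T r
  proof (induct rule: undirected_tree_grow_induct)
    case root
    show ?case unfolding P_def by (intro exI[of _ "\<lambda>_. 1"]) (auto dest: no_loops')
  next
    case (attach S u v)
    then obtain x where nz: "\<And>a. a \<in> S \<Longrightarrow> x a \<noteq> 0"
      and x: "\<And>a b. a \<in> S \<Longrightarrow> b \<in> S \<Longrightarrow> (a, b) \<in> parcs T \<Longrightarrow> x a = g a b * x b"
      unfolding P_def by blast
    define y where "y = x(v := g v u * x u)"
    have guv: "g u v * g v u = 1" using g attach by blast
    have "y a \<noteq> 0" if "a \<in> insert v S" for a
      using that nz attach(3) guv by (auto simp: y_def)
    moreover have "y a = g a b * y b"
      if ab: "a \<in> insert v S" "b \<in> insert v S" "(a, b) \<in> parcs T" for a b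
    proof -
      consider "a = v" "b = v" | "a \<in> S" "b \<in> S" | "a = v" "b \<in> S" | "a \<in> S" "b = v"
        using ab by auto
      then show ?thesis
      proof cases
        case 1
        then show ?thesis using ab no_loops' by blast
      next
        case 2
        then show ?thesis using x ab attach(4) by (auto simp: y_def)
      next
        case 3
        then have "b = u" using attach(6) sym ab by blast
        then show ?thesis using 3 attach(3,4) by (auto simp: y_def)
      next
        case 4
        then have "a = u" using attach(6) ab by blast
        then show ?thesis using 4 attach(3,4) guv by (auto simp: y_def mult.assoc[symmetric])
      qed
    qed
    ultimately show ?case unfolding P_def by (intro exI[of _ y]) blast
  qed
  then obtain x where "\<forall>v\<in>pverts T. x v \<noteq> 0"
      "\<forall>u\<in>pverts T. \<forall>v\<in>pverts T. (u, v) \<in> parcs T \<longrightarrow> x u = g u v * x v"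
    unfolding P_def by blast
  then show thesis
    using that[of x] by (meson in_arcsD1 in_arcsD2)
qed

section \<open>Eigenvectors of the Laplacian\<close>

lemma (in pair_fin_digraph) laplacian_mult_vec_index:
  fixes x :: "'a \<Rightarrow> real"
  assumes "distinct vs" and "set vs = pverts G" and i: "i < length vs"
  shows "(laplacian vs G *\<^sub>v vec (length vs) (\<lambda>j. x (vs ! j))) $ i =
           (\<Sum>w | (vs ! i, w) \<in> parcs G. x (vs ! i) - x w)"
proof -
  let ?n = "length vs" and ?N = "{w. (vs ! i, w) \<in> parcs G}"
  have bij: "bij_betw ((!) vs) {0..<?n} (pverts G)"
    using bij_betw_nth[OF assms(1), of "{0..<?n}" "pverts G"] assms(2)
    by (simp add: atLeast0LessThan)
  have N: "?N \<subseteq> pverts G" by (auto dest: in_arcsD2)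
  have fin: "finite ?N" using finite_subset[OF N pair_finite_verts] .
  have "out_arcs G (vs ! i) = Pair (vs ! i) ` ?N"
    by (auto simp: out_arcs_def)
  then have deg: "out_degree G (vs ! i) = card ?N"
    by (simp add: out_degree_def card_image inj_on_def)
  have "(laplacian vs G *\<^sub>v vec ?n (\<lambda>j. x (vs ! j))) $ i =
      (\<Sum>j = 0..<?n. ((if i = j then real (card ?N) else 0)
         - (if (vs ! i, vs ! j) \<in> parcs G then 1 else 0)) * x (vs ! j))"
    using i by (simp add: laplacian_def degree_matrix_def adjacency_matrix_def scalar_prod_def)
      (auto intro!: sum.cong simp: deg)
  also have "\<dots> = (\<Sum>j = 0..<?n. if i = j then real (card ?N) * x (vs ! j) else 0)
      - (\<Sum>j = 0..<?n. if (vs ! i, vs ! j) \<in> parcs G then x (vs ! j) else 0)"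
    unfolding sum_subtractf[symmetric] by (rule sum.cong) (auto simp: algebra_simps)
  also have "(\<Sum>j = 0..<?n. if i = j then real (card ?N) * x (vs ! j) else 0)
      = (\<Sum>w\<in>?N. x (vs ! i))"
    using i by simp
  also have "(\<Sum>j = 0..<?n. if (vs ! i, vs ! j) \<in> parcs G then x (vs ! j) else 0)
      = (\<Sum>w\<in>pverts G. if (vs ! i, w) \<in> parcs G then x w else 0)"
    by (rule sum.reindex_bij_betw[OF bij])
  also have "\<dots> = (\<Sum>w\<in>?N. x w)"
    using N pair_finite_verts by (simp add: sum.If_cases Int_absorb1)
  finally show ?thesis by (simp add: sum_subtractf)
qed

lemma (in pair_fin_digraph) eigenvalue_laplacianI:
  fixes x :: "'a \<Rightarrow> real"
  assumes "distinct vs" and "set vs = pverts G"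
    and "r \<in> pverts G" and "x r \<noteq> 0"
    and eq: "\<And>v. v \<in> pverts G \<Longrightarrow> (\<Sum>w | (v, w) \<in> parcs G. x v - x w) = k * x v"
  shows "eigenvalue (laplacian vs G) k"
proof -
  let ?n = "length vs" and ?x = "vec (length vs) (\<lambda>j. x (vs ! j))"
  have dim: "dim_row (laplacian vs G) = ?n"
    by (simp add: laplacian_def degree_matrix_def adjacency_matrix_def)
  obtain i where "i < ?n" "vs ! i = r"
    using assms by (metis in_set_conv_nth)
  then have "?x $ i \<noteq> 0\<^sub>v ?n $ i" using \<open>x r \<noteq> 0\<close> by simp
  then have "?x \<noteq> 0\<^sub>v ?n" by metis
  moreover have "laplacian vs G *\<^sub>v ?x = k \<cdot>\<^sub>v ?x"
  proof (rule eq_vecI)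
    fix i assume "i < dim_vec (k \<cdot>\<^sub>v ?x)"
    then have i: "i < ?n" by simp
    then have "vs ! i \<in> pverts G" using assms(2) nth_mem by metis
    then show "(laplacian vs G *\<^sub>v ?x) $ i = (k \<cdot>\<^sub>v ?x) $ i"
      unfolding laplacian_mult_vec_index[OF assms(1,2) i] using eq i by simp
  qed (simp add: dim)
  ultimately show ?thesis
    unfolding eigenvalue_def eigenvector_def dim by (intro exI[of _ ?x]) simp
qed

section \<open>Trees partitioned into stars\<close>

text \<open>
  The requirement \<open>k > 0\<close> makes the profile \<open>(k, -1, \<dots>, -1)\<close> vanish nowhere; only then can the
  value at one vertex of a star be prescribed by the edge through which the star is reached.
\<close>

theorem eigenvalue_laplacian_star_partition:
  fixes T :: "'v pair_pre_digraph" and c :: "'i \<Rightarrow> 'v" and L :: "'i \<Rightarrow> 'v set"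
  assumes T: "undirected_tree T" and vs: "distinct vs" "set vs = pverts T"
    and part: "pverts T = (\<Union>i\<in>I. insert (c i) (L i))"
    and disj: "\<And>i j. i \<in> I \<Longrightarrow> j \<in> I \<Longrightarrow> i \<noteq> j \<Longrightarrow> insert (c i) (L i) \<inter> insert (c j) (L j) = {}"
    and star: "\<And>i. i \<in> I \<Longrightarrow> c i \<notin> L i" "\<And>i. i \<in> I \<Longrightarrow> card (L i) = k"
      "\<And>i. i \<in> I \<Longrightarrow> {c i} \<times> L i \<subseteq> parcs T"
    and "k > 0"
  shows "eigenvalue (laplacian vs T) (real k + 1)"
proof -
  interpret pair_graph T using T by (simp add: undirected_tree_def)
  have sym: "(b, a) \<in> parcs T" if "(a, b) \<in> parcs T" for a b
    using that by (rule arcs_symmetric)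
  define E where "E = (\<Union>i\<in>I. {c i} \<times> L i \<union> L i \<times> {c i})"
  \<comment> \<open>The eigenfunction of a single star, placed on all stars at once.\<close>
  define w :: "'v \<Rightarrow> real" where "w v = (if v \<in> c ` I then real k else - 1)" for v
  define g where "g u v = (if (u, v) \<in> E then w u / w v else 1)" for u v
  have w_nz: "w v \<noteq> 0" for v using \<open>k > 0\<close> by (simp add: w_def)
  have E_sym: "(u, v) \<in> E \<longleftrightarrow> (v, u) \<in> E" for u v by (auto simp: E_def)
  have wc: "w (c i) = real k" if "i \<in> I" for i using that by (simp add: w_def)
  have wl: "w l = - 1" if "i \<in> I" "l \<in> L i" for i l
    using that disj star(1) unfolding w_def by fastforce
  have "g u v * g v u = 1" for u v
    using w_nz E_sym[of u v] by (auto simp: g_def)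
  then obtain x where nz: "\<And>v. v \<in> pverts T \<Longrightarrow> x v \<noteq> 0"
    and x: "\<And>u v. (u, v) \<in> parcs T \<Longrightarrow> x u = g u v * x v"
    using undirected_tree_gain_potential[OF T, of g] by blast
  \<comment> \<open>Within each star, \<open>x\<close> is the multiple \<open>- x l\<close> of the profile \<open>w\<close>, for any leaf \<open>l\<close>.\<close>
  have leaf: "x (c i) = - real k * x l" if "i \<in> I" "l \<in> L i" for i l
  proof -
    have "(c i, l) \<in> parcs T" "(c i, l) \<in> E" using that star(3) by (auto simp: E_def)
    then show ?thesis using x[of "c i" l] that wc wl by (simp add: g_def)
  qed
  have E_sub: "E \<subseteq> parcs T" using star(3) sym by (auto simp: E_def)
  \<comment> \<open>The gain is 1 on the remaining edges, so they drop out of the Laplacian.\<close>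
  have red: "(\<Sum>u | (v, u) \<in> parcs T. x v - x u) = (\<Sum>u | (v, u) \<in> E. x v - x u)" for v
  proof (rule sum.mono_neutral_right)
    have "{u. (v, u) \<in> parcs T} \<subseteq> pverts T" by (auto dest: in_arcsD2)
    then show "finite {u. (v, u) \<in> parcs T}" using pair_finite_verts finite_subset by blast
    show "{u. (v, u) \<in> E} \<subseteq> {u. (v, u) \<in> parcs T}" using E_sub by auto
    show "\<forall>u\<in>{u. (v, u) \<in> parcs T} - {u. (v, u) \<in> E}. x v - x u = 0"
    proof
      fix u assume "u \<in> {u. (v, u) \<in> parcs T} - {u. (v, u) \<in> E}"
      then show "x v - x u = 0" using x[of v u] by (simp add: g_def)
    qed
  qed
  have eq: "(\<Sum>u | (v, u) \<in> parcs T. x v - x u) = (real k + 1) * x v"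
    if v: "v \<in> pverts T" for v
  proof -
    obtain i where i: "i \<in> I" "v \<in> insert (c i) (L i)" using v part by blast
    have only: "j = i" if "j \<in> I" "v \<in> insert (c j) (L j)" for j
      using disj i that by blast
    have Ev: "(v, u) \<in> E \<longleftrightarrow> v = c i \<and> u \<in> L i \<or> v \<in> L i \<and> u = c i" for u
      using i only unfolding E_def by blast
    show ?thesis
    proof (cases "v = c i")
      case True
      have "{u. (v, u) \<in> E} = L i"
        using True i star(1) unfolding Ev by auto
      moreover have "x v - x l = (real k + 1) / real k * x v" if "l \<in> L i" for l
        using leaf[OF i(1) that] True \<open>k > 0\<close> by (simp add: field_simps)
      ultimately have "(\<Sum>u | (v, u) \<in> E. x v - x u) = real k * ((real k + 1) / real k * x v)"
        using star(2)[OF i(1)] by simp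
      then show ?thesis using \<open>k > 0\<close> red by simp
    next
      case False
      then have l: "v \<in> L i" using i by auto
      have "{u. (v, u) \<in> E} = {c i}"
        using False l unfolding Ev by auto
      then show ?thesis using leaf[OF i(1) l] red by (simp add: algebra_simps)
    qed
  qed
  obtain r where "r \<in> pverts T"
    using T unfolding undirected_tree_def connected_def strongly_connected_def
    by auto
  then show ?thesis
    using eigenvalue_laplacianI[OF vs _ nz eq] by blast
qed

text \<open>
  The isomorphism carries its own end maps for the arcs of the image. As the image is a graph whose
  arcs are pairs, these are the projections, and the arc map is determined by the vertex map.
\<close>

lemma digraph_iso_star13E:
  assumes "digraph_iso (with_proj star13) (with_proj H)"
  obtains c L where "c \<notin> L" "card L = 3" "pverts H = insert c L" "{c} \<times> L \<subseteq> parcs H"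
proof -
  obtain f where f: "pre_digraph.digraph_isomorphism (with_proj star13) f"
    and H: "with_proj H = app_iso f (with_proj star13)"
    using assms unfolding digraph_iso_def by blast
  let ?h = "iso_verts f"
  have inj: "inj_on ?h {0, 1, 2, 3}"
    using pre_digraph.digraph_isomorphism_inj_on_verts[OF f] by (simp add: star13_def)
  have V: "pverts H = ?h ` {0, 1, 2, 3}"
    using arg_cong[OF H, of verts] by (simp add: star13_def)
  have A: "parcs H = iso_arcs f ` parcs star13"
    using arg_cong[OF H, of arcs] by simp
  have ends: "iso_tail f = fst" "iso_head f = snd"
    using arg_cong[OF H, of tail] arg_cong[OF H, of head] by simp_all
  have "iso_arcs f (a, b) = (?h a, ?h b)" if "(a, b) \<in> parcs star13" for a b
    using that f unfolding pre_digraph.digraph_isomorphism_def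
    by (metis ends fst_conv snd_conv prod.collapse with_proj_simps(2,4,5))
  then have "(?h a, ?h b) \<in> parcs H" if "(a, b) \<in> parcs star13" for a b
    using that A by (metis image_eqI)
  then have "{?h 0} \<times> ?h ` {1, 2, 3} \<subseteq> parcs H"
    by (auto simp: star13_def)
  moreover have "?h 0 \<notin> ?h ` {1, 2, 3}" "card (?h ` {1, 2, 3}) = 3"
    using inj by (auto simp: inj_on_def)
  ultimately show thesis
    by (intro that[of "?h 0" "?h ` {1, 2, 3}"]) (simp_all add: V)
qed

theorem corollary5p1:
  fixes T :: "'v pair_pre_digraph" and vs :: "'v list" and n m :: nat
  assumes "undirected_tree T"
    and "card (pverts T) = n"
    and "real m = real n / 4"
    and "distinct vs" and "set vs = pverts T"
    and "spanned_by_disjoint_copies star13 m T"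
  shows "eigenvalue (laplacian vs T) 4"
proof -
  obtain H :: "nat \<Rightarrow> 'v pair_pre_digraph" where
    H: "\<forall>i\<in>{1..m}. subgraph (with_proj (H i)) (with_proj T) \<and>
                    digraph_iso (with_proj star13) (with_proj (H i))"
    and cover: "pverts T = (\<Union>i\<in>{1..m}. pverts (H i))"
    and disj: "\<forall>i\<in>{1..m}. \<forall>j\<in>{1..m}. i \<noteq> j \<longrightarrow> pverts (H i) \<inter> pverts (H j) = {}"
    using assms(6) unfolding spanned_by_disjoint_copies_def by (elim exE conjE) (rule that)
  have "\<exists>c L. c \<notin> L \<and> card L = 3 \<and> pverts (H i) = insert c L \<and> {c} \<times> L \<subseteq> parcs (H i)"
    if "i \<in> {1..m}" for i
  proof -
    have "digraph_iso (with_proj star13) (with_proj (H i))"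
      using H that by blast
    then show ?thesis
      by (rule digraph_iso_star13E) blast
  qed
  then obtain c L where star: "\<And>i. i \<in> {1..m} \<Longrightarrow> c i \<notin> L i \<and> card (L i) = 3 \<and>
      pverts (H i) = insert (c i) (L i) \<and> {c i} \<times> L i \<subseteq> parcs (H i)"
    by metis
  have arcs: "parcs (H i) \<subseteq> parcs T" if "i \<in> {1..m}" for i
    using H that by (simp add: subgraph_def)
  have "eigenvalue (laplacian vs T) (real 3 + 1)"
  proof (rule eigenvalue_laplacian_star_partition[OF assms(1,4,5),
        where I = "{1..m}" and c = c and L = L])
    show "pverts T = (\<Union>i\<in>{1..m}. insert (c i) (L i))"
      using cover star by auto
    show "insert (c i) (L i) \<inter> insert (c j) (L j) = {}"
      if "i \<in> {1..m}" "j \<in> {1..m}" "i \<noteq> j" for i j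
      using disj star that by metis
    show "{c i} \<times> L i \<subseteq> parcs T" if "i \<in> {1..m}" for i
      using star[OF that] arcs[OF that] by blast
  qed (use star in auto)
  then show ?thesis by simp
qed

end
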